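(* Let $(B,\underline{*},\overline{*})$ be a biquandle and let $(X,* )$ be a strongly connected $B$-set (so that $(B,X,\underline{*},\overline{*},* )$ is a shadow biquandle with $X$ strongly connected). Then for all $x,y,z\in X$ $$y*\big((x\searrow z)\,\overline{*}\,(x\searrow y)\big)=z*\big((x\searrow y)\,\underline{*}\,(x\searrow z)\big),$$ and the ternary operation $[\,]:X^3\to X$ defined by letting $[x,y,z]$ be this common value, i.e. $$[x,y,z]=y*\big((x\searrow z)\,\overline{*}\,(x\searrow y)\big)=z*\big((x\searrow y)\,\underline{*}\,(x\searrow z)\big),$$ is a horizontal-tribracket on $X$.
   Context: A biquandle is a set $B$ with binary operations $\underline{*},\overline{*}:B\times B\to B$ such that: (i) $a\,\underline{*}\,a=a\,\overline{*}\,a$ for all $a\in B$; (ii) for every $b\in B$ the maps $B\to B$, $a\mapsto a\,\underline{*}\,b$ and $a\mapsto a\,\overline{*}\,b$ are bijective, and the map $S:B\times B\to B\times B$, $S(a,b)=(b\,\overline{*}\,a,\;a\,\underline{*}\,b)$ is bijective; (iii) for all $a,b,c\in B$: $(a\underline{*}b)\underline{*}(c\underline{*}b)=(a\underline{*}c)\underline{*}(b\overline{*}c)$, $(a\underline{*}b)\overline{*}(c\underline{*}b)=(a\overline{*}c)\underline{*}(b\overline{*}c)$, $(a\overline{*}b)\overline{*}(c\overline{*}b)=(a\overline{*}c)\overline{*}(b\underline{*}c)$. A $B$-set is a set $X$ with a map $*:X\times B\to X$ such that for each $a\in B$ the map $X\to X$, $x\mapsto x*a$ is bijective, and $(x*a)*(b\,\overline{*}\,a)=(x*b)*(a\,\underline{*}\,b)$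 for all $a,b\in B$, $x\in X$. A shadow biquandle $(B,X,\underline{*},\overline{*},* )$ is a pair of a biquandle $B$ and a $B$-set $X$. A $B$-set $X$ is strongly connected if for every $x\in X$ the map $B\to X$, $a\mapsto x*a$ is bijective; then for $x,y\in X$, $x\searrow y\in B$ denotes the unique element $a\in B$ with $x*a=y$. A horizontal-tribracket on a set $X$ is a ternary operation $[\,]:X^3\to X$ such that: (H1) for any $x,y,w\in X$ there is a unique $z\in X$ with $[x,y,z]=w$; for any $x,z,w\in X$ there is a unique $y\in X$ with $[x,y,z]=w$; for any $y,z,w\in X$ there is a unique $x\in X$ with $[x,y,z]=w$; (H2) for all $x,y,z,w\in X$: $[y,[x,y,z],[x,y,w]]=[z,[x,y,z],[x,z,w]]=[w,[x,y,w],[x,z,w]]$. (The pair $(X,[\,])$ is then called a knot-theoretic horizontal-ternary-quasigroup.) *)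

theory Defs
  imports Main
begin

text \<open>
  The structures live on carrier sets, which may be empty. Operations are total functions
  of the ambient types and are constrained only on the carriers.
  \<open>*\<^sub>u\<close> and \<open>*\<^sub>o\<close> stand for the underlined and the overlined star, respectively.
\<close>

locale biquandle =
  fixes B :: "'b set"
    and under :: "'b \<Rightarrow> 'b \<Rightarrow> 'b"  (infixl "*\<^sub>u" 70)
    and over :: "'b \<Rightarrow> 'b \<Rightarrow> 'b"  (infixl "*\<^sub>o" 70)
  assumes under_closed: "a \<in> B \<Longrightarrow> b \<in> B \<Longrightarrow> a *\<^sub>u b \<in> B"
    and over_closed: "a \<in> B \<Longrightarrow> b \<in> B \<Longrightarrow> a *\<^sub>o b \<in> B"
    and diagonal: "a \<in> B \<Longrightarrow> a *\<^sub>u a = a *\<^sub>o a"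
    and bij_under: "b \<in> B \<Longrightarrow> bij_betw (\<lambda>a. a *\<^sub>u b) B B"
    and bij_over: "b \<in> B \<Longrightarrow> bij_betw (\<lambda>a. a *\<^sub>o b) B B"
    and bij_S: "bij_betw (\<lambda>(a, b). (b *\<^sub>o a, a *\<^sub>u b)) (B \<times> B) (B \<times> B)"
    and exchange_uu: "a \<in> B \<Longrightarrow> b \<in> B \<Longrightarrow> c \<in> B \<Longrightarrow>
      (a *\<^sub>u b) *\<^sub>u (c *\<^sub>u b) = (a *\<^sub>u c) *\<^sub>u (b *\<^sub>o c)"
    and exchange_uo: "a \<in> B \<Longrightarrow> b \<in> B \<Longrightarrow> c \<in> B \<Longrightarrow>
      (a *\<^sub>u b) *\<^sub>o (c *\<^sub>u b) = (a *\<^sub>o c) *\<^sub>u (b *\<^sub>o c)"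
    and exchange_oo: "a \<in> B \<Longrightarrow> b \<in> B \<Longrightarrow> c \<in> B \<Longrightarrow>
      (a *\<^sub>o b) *\<^sub>o (c *\<^sub>o b) = (a *\<^sub>o c) *\<^sub>o (b *\<^sub>u c)"

locale shadow_biquandle = biquandle B under over
  for B :: "'b set"
    and under :: "'b \<Rightarrow> 'b \<Rightarrow> 'b"  (infixl "*\<^sub>u" 70)
    and over :: "'b \<Rightarrow> 'b \<Rightarrow> 'b"  (infixl "*\<^sub>o" 70) +
  fixes X :: "'x set"
    and act :: "'x \<Rightarrow> 'b \<Rightarrow> 'x"  (infixl "\<bullet>" 70)
  assumes act_closed: "x \<in> X \<Longrightarrow> a \<in> B \<Longrightarrow> x \<bullet> a \<in> X"
    and bij_act: "a \<in> B \<Longrightarrow> bij_betw (\<lambda>x. x \<bullet> a) X X"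
    and act_exchange: "x \<in> X \<Longrightarrow> a \<in> B \<Longrightarrow> b \<in> B \<Longrightarrow>
      (x \<bullet> a) \<bullet> (b *\<^sub>o a) = (x \<bullet> b) \<bullet> (a *\<^sub>u b)"

definition strongly_connected :: "'b set \<Rightarrow> 'x set \<Rightarrow> ('x \<Rightarrow> 'b \<Rightarrow> 'x) \<Rightarrow> bool" where
  "strongly_connected B X act \<longleftrightarrow> (\<forall>x\<in>X. bij_betw (\<lambda>a. act x a) B X)"

text \<open>\<open>arrow B act x y\<close> is \<open>x \<searrow> y\<close>; it is meaningful for strongly connected actions only.\<close>

definition arrow :: "'b set \<Rightarrow> ('x \<Rightarrow> 'b \<Rightarrow> 'x) \<Rightarrow> 'x \<Rightarrow> 'x \<Rightarrow> 'b" where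
  "arrow B act x y = (THE a. a \<in> B \<and> act x a = y)"

locale horizontal_tribracket =
  fixes X :: "'x set"
    and bracket :: "'x \<Rightarrow> 'x \<Rightarrow> 'x \<Rightarrow> 'x"  ("[_,/ _,/ _]\<^sub>t")
  assumes bracket_closed: "x \<in> X \<Longrightarrow> y \<in> X \<Longrightarrow> z \<in> X \<Longrightarrow> [x, y, z]\<^sub>t \<in> X"
    and H1_third: "x \<in> X \<Longrightarrow> y \<in> X \<Longrightarrow> w \<in> X \<Longrightarrow> \<exists>!z. z \<in> X \<and> [x, y, z]\<^sub>t = w"
    and H1_second: "x \<in> X \<Longrightarrow> z \<in> X \<Longrightarrow> w \<in> X \<Longrightarrow> \<exists>!y. y \<in> X \<and> [x, y, z]\<^sub>t = w"
    and H1_first: "y \<in> X \<Longrightarrow> z \<in> X \<Longrightarrow> w \<in> X \<Longrightarrow> \<exists>!x. x \<in> X \<and> [x, y, z]\<^sub>t = w"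
    and H2_left: "x \<in> X \<Longrightarrow> y \<in> X \<Longrightarrow> z \<in> X \<Longrightarrow> w \<in> X \<Longrightarrow>
      [y, [x, y, z]\<^sub>t, [x, y, w]\<^sub>t]\<^sub>t = [z, [x, y, z]\<^sub>t, [x, z, w]\<^sub>t]\<^sub>t"
    and H2_right: "x \<in> X \<Longrightarrow> y \<in> X \<Longrightarrow> z \<in> X \<Longrightarrow> w \<in> X \<Longrightarrow>
      [z, [x, y, z]\<^sub>t, [x, z, w]\<^sub>t]\<^sub>t = [w, [x, y, w]\<^sub>t, [x, z, w]\<^sub>t]\<^sub>t"

end

theory Submission
  imports Defs
begin

text \<open>
  Writing \<open>a = x \<searrow> y\<close> and \<open>b = x \<searrow> z\<close>, the exchange law of the action says that
  \<open>[x, y, z]\<close> is well defined, and it satisfies \<open>y \<searrow> [x, y, z] = b *\<^sub>o a\<close> and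
  \<open>z \<searrow> [x, y, z] = a *\<^sub>u b\<close>. Hence unique solvability in the first argument is bijectivity
  of \<open>S\<close>, in the other two it is bijectivity of \<open>*\<^sub>u\<close> and \<open>*\<^sub>o\<close>, and the two equations
  of (H2) are the exchange laws of the biquandle for \<open>*\<^sub>o *\<^sub>o\<close> and \<open>*\<^sub>u *\<^sub>u\<close>.
\<close>

lemma bij_betw_ex1:
  assumes f: "bij_betw f A B" and y: "y \<in> B"
  shows "\<exists>!x. x \<in> A \<and> f x = y"
proof -
  have "y \<in> f ` A"
    using f y by (simp add: bij_betw_imp_surj_on)
  then obtain x where "x \<in> A" "f x = y"
    by blast
  with f show ?thesis
    by (intro ex1I[of _ x]) (auto dest: bij_betw_imp_inj_on inj_onD)
qed

locale strongly_connected_shadow_biquandle = shadow_biquandle B under over X act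
  for B :: "'b set"
    and under :: "'b \<Rightarrow> 'b \<Rightarrow> 'b"  (infixl "*\<^sub>u" 70)
    and over :: "'b \<Rightarrow> 'b \<Rightarrow> 'b"  (infixl "*\<^sub>o" 70)
    and X :: "'x set"
    and act :: "'x \<Rightarrow> 'b \<Rightarrow> 'x"  (infixl "\<bullet>" 70) +
  assumes connected: "strongly_connected B X act"
begin

abbreviation arr :: "'x \<Rightarrow> 'x \<Rightarrow> 'b"  (infix "\<searrow>" 75)
  where "x \<searrow> y \<equiv> arrow B act x y"

text \<open>Being abbreviations, \<open>arr\<close> and \<open>br\<close> leave no constants to
  unfold: the facts proved here are about the very terms in the final theorem.\<close>

abbreviation br :: "'x \<Rightarrow> 'x \<Rightarrow> 'x \<Rightarrow> 'x"  ("[_,/ _,/ _]\<^sub>b")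
  where "[x, y, z]\<^sub>b \<equiv> y \<bullet> ((x \<searrow> z) *\<^sub>o (x \<searrow> y))"

lemma bij_orbit: "x \<in> X \<Longrightarrow> bij_betw (\<lambda>a. x \<bullet> a) B X"
  using connected by (simp add: strongly_connected_def)

lemma arr_act: "x \<in> X \<Longrightarrow> a \<in> B \<Longrightarrow> x \<searrow> (x \<bullet> a) = a"
  unfolding arrow_def using bij_betw_imp_inj_on[OF bij_orbit]
  by (auto dest: inj_onD)

lemma arr_closed: "x \<in> X \<Longrightarrow> y \<in> X \<Longrightarrow> x \<searrow> y \<in> B"
  and act_arr: "x \<in> X \<Longrightarrow> y \<in> X \<Longrightarrow> x \<bullet> (x \<searrow> y) = y"
proof -
  assume x: "x \<in> X" and y: "y \<in> X"
  then obtain a where "a \<in> B" "y = x \<bullet> a"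
    using bij_betw_imp_surj_on[OF bij_orbit[OF x]] by blast
  then show "x \<searrow> y \<in> B" "x \<bullet> (x \<searrow> y) = y"
    using x by (simp_all add: arr_act)
qed

lemma act_inj: "x \<in> X \<Longrightarrow> y \<in> X \<Longrightarrow> a \<in> B \<Longrightarrow> x \<bullet> a = y \<bullet> a \<Longrightarrow> x = y"
  using bij_betw_imp_inj_on[OF bij_act] by (auto dest: inj_onD)

lemma br_eq:
  assumes "x \<in> X" "y \<in> X" "z \<in> X"
  shows "[x, y, z]\<^sub>b = z \<bullet> ((x \<searrow> y) *\<^sub>u (x \<searrow> z))"
  using act_exchange[of x "x \<searrow> y" "x \<searrow> z"] assms by (simp add: arr_closed act_arr)

lemma br_closed: "x \<in> X \<Longrightarrow> y \<in> X \<Longrightarrow> z \<in> X \<Longrightarrow> [x, y, z]\<^sub>b \<in> X"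
  by (simp add: act_closed over_closed arr_closed)

lemma arr_br_left:
  "x \<in> X \<Longrightarrow> y \<in> X \<Longrightarrow> z \<in> X \<Longrightarrow> y \<searrow> [x, y, z]\<^sub>b = (x \<searrow> z) *\<^sub>o (x \<searrow> y)"
  by (simp add: arr_act over_closed arr_closed)

lemma arr_br_right:
  "x \<in> X \<Longrightarrow> y \<in> X \<Longrightarrow> z \<in> X \<Longrightarrow> z \<searrow> [x, y, z]\<^sub>b = (x \<searrow> y) *\<^sub>u (x \<searrow> z)"
  by (simp add: br_eq arr_act under_closed arr_closed)

lemma bij_arr: "x \<in> X \<Longrightarrow> bij_betw (\<lambda>y. x \<searrow> y) X B"
  by (rule bij_betw_byWitness[where f' = "\<lambda>a. x \<bullet> a"])
    (auto simp: arr_act act_arr arr_closed act_closed)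

text \<open>The map is a composite of three bijections: \<open>\<lambda>z. x \<searrow> z\<close>
  from \<open>X\<close> to \<open>B\<close>, then \<open>*\<^sub>o\<close> by
  \<open>x \<searrow> y\<close> on the right, then the orbit map of \<open>y\<close>.\<close>

lemma bij_br_third:
  assumes "x \<in> X" "y \<in> X"
  shows "bij_betw (\<lambda>z. [x, y, z]\<^sub>b) X X"
  using bij_betw_trans[OF bij_betw_trans[OF bij_arr[OF assms(1)]
        bij_over[OF arr_closed[OF assms]]] bij_orbit[OF assms(2)]]
  by (simp add: comp_def)

lemma bij_br_second:
  assumes "x \<in> X" "z \<in> X"
  shows "bij_betw (\<lambda>y. [x, y, z]\<^sub>b) X X"
proof -
  \<comment> \<open>In the defining form \<open>y\<close> occurs twice. In the form given by
    \<open>br_eq\<close> it occurs once, and the map is again a composite of bijections.\<close>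
  have "bij_betw (\<lambda>y. z \<bullet> ((x \<searrow> y) *\<^sub>u (x \<searrow> z))) X X"
    using bij_betw_trans[OF bij_betw_trans[OF bij_arr[OF assms(1)]
          bij_under[OF arr_closed[OF assms]]] bij_orbit[OF assms(2)]]
    by (simp add: comp_def)
  then show ?thesis
    by (rule iffD1[OF bij_betw_cong, rotated]) (simp add: br_eq assms)
qed

lemma br_first:
  assumes y: "y \<in> X" and z: "z \<in> X" and w: "w \<in> X"
  shows "\<exists>!x. x \<in> X \<and> [x, y, z]\<^sub>b = w"
proof -
  \<comment> \<open>A solution \<open>x\<close> forces S to send
    \<open>(x \<searrow> y, x \<searrow> z)\<close> to this pair, so its preimage
    \<open>(a, b)\<close> gives the two arrows out of \<open>x\<close>.\<close>
  have "(y \<searrow> w, z \<searrow> w) \<in> B \<times> B"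
    using arr_closed y z w by simp
  also have "\<dots> = (\<lambda>(a, b). (b *\<^sub>o a, a *\<^sub>u b)) ` (B \<times> B)"
    by (rule bij_betw_imp_surj_on[OF bij_S, symmetric])
  finally obtain p where p: "p \<in> B \<times> B"
    and S: "(y \<searrow> w, z \<searrow> w) = (\<lambda>(a, b). (b *\<^sub>o a, a *\<^sub>u b)) p"
    by (rule imageE)
  obtain a b where "p = (a, b)"
    by (rule prod.exhaust)
  with p S have a: "a \<in> B" and b: "b \<in> B"
    and over: "b *\<^sub>o a = y \<searrow> w" and under: "a *\<^sub>u b = z \<searrow> w"
    by simp_all
  \<comment> \<open>Only \<open>a\<close> is used to locate \<open>x\<close>; that \<open>b\<close>
    then leads from \<open>x\<close> to \<open>z\<close> has to be checked.\<close>
  have "y \<in> (\<lambda>x. x \<bullet> a) ` X"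
    using bij_betw_imp_surj_on[OF bij_act[OF a]] y by simp
  then obtain x where x: "x \<in> X" and xa: "x \<bullet> a = y"
    by blast
  \<comment> \<open>Both \<open>x \<bullet> b\<close> and \<open>z\<close> are carried to
    \<open>w\<close> by \<open>z \<searrow> w\<close>, which acts injectively.\<close>
  have "(x \<bullet> b) \<bullet> (z \<searrow> w) = y \<bullet> (y \<searrow> w)"
    using act_exchange[OF x a b] by (simp add: over under xa)
  also have "\<dots> = z \<bullet> (z \<searrow> w)"
    by (simp add: act_arr y z w)
  finally have xb: "x \<bullet> b = z"
    by (rule act_inj[rotated 3]) (simp_all add: act_closed arr_closed x b z w)
  show ?thesis
  proof (intro ex1I conjI)
    show "x \<in> X" by (fact x)
    show "[x, y, z]\<^sub>b = w"
      using arr_act[OF x a] arr_act[OF x b] by (simp add: xa xb over act_arr y w)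
  next
    fix x' assume x': "x' \<in> X \<and> [x', y, z]\<^sub>b = w"
    \<comment> \<open>The arrows out of any other solution have the same image under S as
      \<open>(a, b)\<close>, hence equal it; acting by \<open>a\<close> then identifies the two
      points.\<close>
    have "(x' \<searrow> z) *\<^sub>o (x' \<searrow> y) = b *\<^sub>o a" "(x' \<searrow> y) *\<^sub>u (x' \<searrow> z) = a *\<^sub>u b"
      using arr_br_left[of x' y z] arr_br_right[of x' y z] x' y z by (auto simp: over under)
    then have "(x' \<searrow> y, x' \<searrow> z) = (a, b)"
      by - (rule bij_betw_imp_inj_on[OF bij_S, THEN inj_onD],
        simp_all add: arr_closed x' y z a b)
    then have "x' \<bullet> a = x \<bullet> a"
      using act_arr[of x' y] x' y xa by simp
    then show "x' = x"
      using act_inj a x x' by blast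
  qed
qed

text \<open>Both outer brackets act on the same point \<open>[x, y, z]\<close>, so it suffices to
  compare the acting elements of \<open>B\<close>.\<close>

lemma br_exchange_left:
  assumes "x \<in> X" "y \<in> X" "z \<in> X" "w \<in> X"
  shows "[y, [x, y, z]\<^sub>b, [x, y, w]\<^sub>b]\<^sub>b = [z, [x, y, z]\<^sub>b, [x, z, w]\<^sub>b]\<^sub>b"
  using assms exchange_oo[of "x \<searrow> w" "x \<searrow> y" "x \<searrow> z"]
  by (simp only: arr_br_left arr_br_right arr_closed)

lemma br_exchange_right:
  assumes "x \<in> X" "y \<in> X" "z \<in> X" "w \<in> X"
  shows "[z, [x, y, z]\<^sub>b, [x, z, w]\<^sub>b]\<^sub>b = [w, [x, y, w]\<^sub>b, [x, z, w]\<^sub>b]\<^sub>b"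
proof -
  \<comment> \<open>In the form of \<open>br_eq\<close> the common point acted on is
    \<open>[x, z, w]\<close>, and these are the two acting elements.\<close>
  have "(z \<searrow> [x, y, z]\<^sub>b) *\<^sub>u (z \<searrow> [x, z, w]\<^sub>b) = (w \<searrow> [x, y, w]\<^sub>b) *\<^sub>u (w \<searrow> [x, z, w]\<^sub>b)"
    using assms exchange_uu[of "x \<searrow> y" "x \<searrow> w" "x \<searrow> z"]
    by (simp only: arr_br_left arr_br_right arr_closed)
  then show ?thesis
    \<comment> \<open>The instances of \<open>br_eq\<close> rewrite the outer brackets and leave the
      inner ones alone.\<close>
    using assms by (simp only: br_eq[of z "[x, y, z]\<^sub>b"] br_eq[of w "[x, y, w]\<^sub>b"] br_closed)
qed

sublocale horizontal_tribracket X br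
proof
  fix x y w assume "x \<in> X" "y \<in> X" "w \<in> X"
  then show "\<exists>!z. z \<in> X \<and> [x, y, z]\<^sub>b = w"
    by (rule bij_betw_ex1[OF bij_br_third])
next
  fix x z w assume "x \<in> X" "z \<in> X" "w \<in> X"
  then show "\<exists>!y. y \<in> X \<and> [x, y, z]\<^sub>b = w"
    by (rule bij_betw_ex1[OF bij_br_second])
next
  fix x y z w assume "x \<in> X" "y \<in> X" "z \<in> X" "w \<in> X"
  then show "[y, [x, y, z]\<^sub>b, [x, y, w]\<^sub>b]\<^sub>b = [z, [x, y, z]\<^sub>b, [x, z, w]\<^sub>b]\<^sub>b"
    and "[z, [x, y, z]\<^sub>b, [x, z, w]\<^sub>b]\<^sub>b = [w, [x, y, w]\<^sub>b, [x, z, w]\<^sub>b]\<^sub>b"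
    by (fact br_exchange_left, fact br_exchange_right)
qed (fact br_closed br_first)+

end

theorem theorem4p1:
  fixes B :: "'b set"
    and under over :: "'b \<Rightarrow> 'b \<Rightarrow> 'b"
    and X :: "'x set"
    and act :: "'x \<Rightarrow> 'b \<Rightarrow> 'x"
  assumes "shadow_biquandle B under over X act"
    and "strongly_connected B X act"
  shows "(\<forall>x\<in>X. \<forall>y\<in>X. \<forall>z\<in>X.
            act y (over (arrow B act x z) (arrow B act x y))
          = act z (under (arrow B act x y) (arrow B act x z)))
       \<and> horizontal_tribracket X
          (\<lambda>x y z. act y (over (arrow B act x z) (arrow B act x y)))"
proof -
  interpret strongly_connected_shadow_biquandle B under over X act
    using assms
    by (simp add: strongly_connected_shadow_biquandle_def
        strongly_connected_shadow_biquandle_axioms_def)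
  show ?thesis
    using br_eq horizontal_tribracket_axioms by blast
qed

end
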